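(* Let the weights $\alpha_{ij}$, $i,j\in[n]$, be such that for every $i\in[n]$ $$\mathbb E\left[\sum_{j\in[n]}\tau_j(r+1)\tau_{ij}(r+1)\alpha_{ji}\right]=p_i\alpha_{ii}+\sum_{j\ne i}p_jp_{ij}\alpha_{ji}=1.$$ Then for every $i\in[n]$ and every $r\ge0$, $$\frac1n\,\mathbb E\left[\sum_{j\in[n]}\tau_j(r+1)\tau_{ij}(r+1)\alpha_{ji}\,\Delta\mathbf x_i^{r+1}\,\Big|\,\Delta\mathbf x_i^{r+1}\right]=\frac1n\,\Delta\mathbf x_i^{r+1}.$$
   Context: $[n]=\{1,\dots,n\}$ indexes clients. $\Delta\mathbf x_i^{r+1}$ is an (integrable) random vector in $\mathbb R^d$, the local model update of client $i$ at the end of round $r$. $\tau_i(r)\sim\mathrm{Bernoulli}(p_i)$ indicates availability of the link from client $i$ to the parameter server in round $r$; $\tau_{ij}(r)\sim\mathrm{Bernoulli}(p_{ij})$ indicates availability of the link from client $i$ to client $j$, with $p_{ii}=1$. The $\tau_i(r)$ are independent across clients and rounds, the families $(\tau_i)$ and $(\tau_{ij})$ are independent of each other, and $\tau_{ij}(r)$, $\tau_{lm}(r')$ are independent unless $r=r'$ and $(l,m)\in\{(i,j),(j,i)\}$. The variables $(\tau_i(r+1))_i,(\tau_{ij}(r+1))_{i,j}$ are independent of $\Delta\mathbf x_l^{r+1}$ for every $l\in[n]$. The weights $\alpha_{ij}$ are deterministic real numbers ($\alpha_{ij}$ is the weight client $i$ uses to relay client $j$'s update). *)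

theory Defs
  imports "HOL-Probability.Probability"
begin

(* Conditional expectation of a random vector is taken coordinatewise.  As with real_cond_exp, it
   is meaningful only for integrable f, and only up to M-null sets. *)
definition vec_cond_exp ::
    "'a measure \<Rightarrow> 'a measure \<Rightarrow> ('a \<Rightarrow> real ^ 'd) \<Rightarrow> 'a \<Rightarrow> real ^ 'd" where
  "vec_cond_exp M F f = (\<lambda>\<omega>. \<chi> k. real_cond_exp M F (\<lambda>\<omega>'. f \<omega>' $ k) \<omega>)"

(* E[f | X] = E[f | sigma(X)] *)
definition vec_cond_exp_rv ::
    "'a measure \<Rightarrow> ('a \<Rightarrow> real ^ 'd) \<Rightarrow> ('a \<Rightarrow> real ^ 'd) \<Rightarrow> 'a \<Rightarrow> real ^ 'd" where
  "vec_cond_exp_rv M f X = vec_cond_exp M (vimage_algebra (space M) X borel) f"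

definition bernoulli_rv :: "'a measure \<Rightarrow> real \<Rightarrow> ('a \<Rightarrow> real) \<Rightarrow> bool" where
  "bernoulli_rv M p X \<longleftrightarrow> 0 \<le> p \<and> p \<le> 1 \<and> X \<in> borel_measurable M \<and>
     distr M borel X = distr (measure_pmf (bernoulli_pmf p)) borel of_bool"

(* indep_var requires both random elements to take values in the same type; this is the
   characterisation indep_var_eq without that restriction. *)
definition (in prob_space) indep_elems ::
    "'b measure \<Rightarrow> ('a \<Rightarrow> 'b) \<Rightarrow> 'c measure \<Rightarrow> ('a \<Rightarrow> 'c) \<Rightarrow> bool" where
  "indep_elems S X T Y \<longleftrightarrow>
     random_variable S X \<and> random_variable T Y \<and>
     indep_set
       (sigma_sets (space M) {X -` A \<inter> space M | A. A \<in> sets S})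
       (sigma_sets (space M) {Y -` A \<inter> space M | A. A \<in> sets T})"

(* Clients are 1, ..., n.  up i r is tau_i(r) (uplink to the parameter server), link i j r is
   tau_ij(r), and dx i r is the local update with superscript r; only dx i (Suc r) is used.
   Bernoulli variables are real-valued with the law of a Bernoulli variable on {0, 1}. *)
locale relay_network = prob_space M
  for M :: "'a measure" +
  fixes n :: nat
    and p :: "nat \<Rightarrow> real"
    and pp :: "nat \<Rightarrow> nat \<Rightarrow> real"
    and up :: "nat \<Rightarrow> nat \<Rightarrow> 'a \<Rightarrow> real"
    and link :: "nat \<Rightarrow> nat \<Rightarrow> nat \<Rightarrow> 'a \<Rightarrow> real"
    and dx :: "nat \<Rightarrow> nat \<Rightarrow> 'a \<Rightarrow> real ^ 'd"
  assumes dx_integrable: "i \<in> {1..n} \<Longrightarrow> integrable M (dx i (Suc r))"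
    and up_bernoulli: "i \<in> {1..n} \<Longrightarrow> bernoulli_rv M (p i) (up i r)"
    and link_bernoulli:
      "i \<in> {1..n} \<Longrightarrow> j \<in> {1..n} \<Longrightarrow> bernoulli_rv M (pp i j) (link i j r)"
    and pp_diag: "i \<in> {1..n} \<Longrightarrow> pp i i = 1"
    and up_indep: "indep_vars (\<lambda>_. borel) (\<lambda>(i, r). up i r) ({1..n} \<times> UNIV)"
    and up_link_indep:
      "indep_elems
         (Pi\<^sub>M ({1..n} \<times> UNIV) (\<lambda>_. borel))
         (\<lambda>\<omega>. \<lambda>(i, r)\<in>{1..n} \<times> UNIV. up i r \<omega>)
         (Pi\<^sub>M ({1..n} \<times> {1..n} \<times> UNIV) (\<lambda>_. borel))
         (\<lambda>\<omega>. \<lambda>(i, j, r)\<in>{1..n} \<times> {1..n} \<times> UNIV. link i j r \<omega>)"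
    and link_indep:
      "i \<in> {1..n} \<Longrightarrow> j \<in> {1..n} \<Longrightarrow> l \<in> {1..n} \<Longrightarrow> m \<in> {1..n} \<Longrightarrow>
       \<not> (r = r' \<and> (l, m) \<in> {(i, j), (j, i)}) \<Longrightarrow>
       indep_var borel (link i j r) borel (link l m r')"
    and network_dx_indep:
      "l \<in> {1..n} \<Longrightarrow>
       indep_elems
         (Pi\<^sub>M {1..n} (\<lambda>_. borel) \<Otimes>\<^sub>M Pi\<^sub>M ({1..n} \<times> {1..n}) (\<lambda>_. borel))
         (\<lambda>\<omega>. (\<lambda>i\<in>{1..n}. up i (Suc r) \<omega>,
               \<lambda>(i, j)\<in>{1..n} \<times> {1..n}. link i j (Suc r) \<omega>))
         borel (dx l (Suc r))"
begin

lemma bernoulli_rv_expectation: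
  assumes "bernoulli_rv M q X"
  shows "integrable M X" "expectation X = q"
proof -
  have X[measurable]: "X \<in> borel_measurable M" and q: "0 \<le> q" "q \<le> 1"
    and d: "distr M borel X = distr (measure_pmf (bernoulli_pmf q)) borel of_bool"
    using assms by (auto simp: bernoulli_rv_def)
  have "integrable (measure_pmf (bernoulli_pmf q)) (of_bool :: bool \<Rightarrow> real)"
    by (intro measure_pmf.integrable_const_bound[where B=1]) auto
  then have "integrable (distr M borel X) (\<lambda>x. x)"
    unfolding d by (subst integrable_distr_eq) auto
  then show "integrable M X"
    by (subst (asm) integrable_distr_eq) auto
  have "expectation X = integral\<^sup>L (distr M borel X) (\<lambda>x. x)"
    by (subst integral_distr) auto
  also have "\<dots> = q"
    unfolding d using q by (subst integral_distr) auto
  finally show "expectation X = q" .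
qed

lemma up_link_indep_var:
  assumes ij: "i \<in> {1..n}" "j \<in> {1..n}" "l \<in> {1..n}"
  shows "indep_var borel (up j r) borel (link i l r')"
proof -
  let ?U = "\<lambda>\<omega>. \<lambda>(i, r)\<in>{1..n} \<times> (UNIV :: nat set). up i r \<omega>"
  let ?L = "\<lambda>\<omega>. \<lambda>(i, j, r)\<in>{1..n} \<times> {1..n} \<times> (UNIV :: nat set). link i j r \<omega>"
  let ?S = "Pi\<^sub>M ({1..n} \<times> (UNIV :: nat set)) (\<lambda>_. borel :: real measure)"
  let ?T = "Pi\<^sub>M ({1..n} \<times> {1..n} \<times> (UNIV :: nat set)) (\<lambda>_. borel :: real measure)"
  have ind: "indep_set (sigma_sets (space M) {?U -` A \<inter> space M | A. A \<in> sets ?S})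
                       (sigma_sets (space M) {?L -` A \<inter> space M | A. A \<in> sets ?T})"
    and U: "random_variable ?S ?U" and L: "random_variable ?T ?L"
    using up_link_indep unfolding indep_elems_def by auto
  have up: "random_variable borel (up j r)" and lk: "random_variable borel (link i l r')"
    using up_bernoulli[of j r] link_bernoulli[of i l r'] ij by (auto simp: bernoulli_rv_def)
  have "sigma_sets (space M) {up j r -` A \<inter> space M | A. A \<in> sets borel}
      \<subseteq> sigma_sets (space M) {?U -` A \<inter> space M | A. A \<in> sets ?S}"
  proof (intro sigma_sets_mono' subsetI)
    fix D assume "D \<in> {up j r -` A \<inter> space M | A. A \<in> sets borel}"
    then obtain A where A: "A \<in> sets borel" "D = up j r -` A \<inter> space M" by auto
    have m: "(\<lambda>f. f (j, r)) \<in> measurable ?S borel"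
      using ij by (intro measurable_component_singleton) auto
    have "D = ?U -` ((\<lambda>f. f (j, r)) -` A \<inter> space ?S) \<inter> space M"
      using A ij measurable_space[OF U] by auto
    then show "D \<in> {?U -` A \<inter> space M | A. A \<in> sets ?S}"
      using measurable_sets[OF m A(1)] by blast
  qed
  moreover have "sigma_sets (space M) {link i l r' -` A \<inter> space M | A. A \<in> sets borel}
      \<subseteq> sigma_sets (space M) {?L -` A \<inter> space M | A. A \<in> sets ?T}"
  proof (intro sigma_sets_mono' subsetI)
    fix D assume "D \<in> {link i l r' -` A \<inter> space M | A. A \<in> sets borel}"
    then obtain A where A: "A \<in> sets borel" "D = link i l r' -` A \<inter> space M" by auto
    have m: "(\<lambda>f. f (i, l, r')) \<in> measurable ?T borel"
      using ij by (intro measurable_component_singleton) auto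
    have "D = ?L -` ((\<lambda>f. f (i, l, r')) -` A \<inter> space ?T) \<inter> space M"
      using A ij measurable_space[OF L] by auto
    then show "D \<in> {?L -` A \<inter> space M | A. A \<in> sets ?T}"
      using measurable_sets[OF m A(1)] by blast
  qed
  ultimately show ?thesis
    unfolding indep_var_eq using up lk ind unfolding indep_sets2_eq by blast
qed

(* The expectation equals the closed form for all weights, so assuming this identity next to
   "= 1" restricts nothing. *)
lemma expectation_weights:
  fixes \<alpha> :: "nat \<Rightarrow> nat \<Rightarrow> real"
  assumes i: "i \<in> {1..n}"
  shows "expectation (\<lambda>\<omega>. \<Sum>j\<in>{1..n}. up j (Suc r) \<omega> * link i j (Suc r) \<omega> * \<alpha> j i)
       = p i * \<alpha> i i + (\<Sum>j\<in>{1..n} - {i}. p j * pp i j * \<alpha> j i)"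
proof -
  have *: "integrable M (\<lambda>\<omega>. up j (Suc r) \<omega> * link i j (Suc r) \<omega>)"
    "expectation (\<lambda>\<omega>. up j (Suc r) \<omega> * link i j (Suc r) \<omega>) = p j * pp i j"
    if j: "j \<in> {1..n}" for j
    using bernoulli_rv_expectation[OF up_bernoulli[OF j, of "Suc r"]]
      bernoulli_rv_expectation[OF link_bernoulli[OF i j, of "Suc r"]]
      indep_var_lebesgue_integral[OF up_link_indep_var[OF i j j]]
      indep_var_integrable[OF up_link_indep_var[OF i j j]] by auto
  have "expectation (\<lambda>\<omega>. \<Sum>j\<in>{1..n}. up j (Suc r) \<omega> * link i j (Suc r) \<omega> * \<alpha> j i)
      = (\<Sum>j\<in>{1..n}. p j * pp i j * \<alpha> j i)"
    using * by (subst Bochner_Integration.integral_sum) auto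
  also have "\<dots> = p i * \<alpha> i i + (\<Sum>j\<in>{1..n} - {i}. p j * pp i j * \<alpha> j i)"
    using i by (subst sum.remove[of _ i]) (auto simp: pp_diag)
  finally show ?thesis .
qed

end

end

(* The coefficient W = sum_j tau_j tau_ij alpha_ji is a measurable function of the round's network
   variables, hence independent of X = dx i.  X is sigma(X)-measurable, so on every A in sigma(X)
   the integral of W X_k factors as E[W] E[1_A X_k] = E[1_A X_k], which characterises X_k as the
   conditional expectation of W X_k. *)
theory Submission
  imports Defs
begin

text \<open>Preimages under a composition are preimages under the inner map of measurable sets, so
  composing can only shrink the generated sigma-algebras, and independence passes to smaller ones.
  Since \<open>f\<close> and \<open>g\<close> land in a common type, the product rule for
  \<open>indep_var\<close> becomes available even when \<open>X\<close> and \<open>Y\<close> differ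
  in type.\<close>

lemma (in prob_space) indep_elems_compose:
  assumes ind: "indep_elems S X T Y"
    and f: "f \<in> measurable S N" and g: "g \<in> measurable T N'"
  shows "indep_var N (\<lambda>\<omega>. f (X \<omega>)) N' (\<lambda>\<omega>. g (Y \<omega>))"
proof -
  have X: "random_variable S X" and Y: "random_variable T Y"
    and set: "indep_set (sigma_sets (space M) {X -` A \<inter> space M | A. A \<in> sets S})
                        (sigma_sets (space M) {Y -` A \<inter> space M | A. A \<in> sets T})"
    using ind unfolding indep_elems_def by auto
  \<comment> \<open>Kept polymorphic so that it serves both \<open>X\<close> with \<open>f\<close>
    and \<open>Y\<close> with \<open>g\<close>.\<close>
  have sub: "sigma_sets (space M) {(\<lambda>\<omega>. h (Z \<omega>)) -` A \<inter> space M | A. A \<in> sets Q}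
      \<subseteq> sigma_sets (space M) {Z -` A \<inter> space M | A. A \<in> sets R}"
    if Z: "random_variable R Z" and h: "h \<in> measurable R Q" for Z R Q and h :: "'x \<Rightarrow> 'y"
  proof (intro sigma_sets_mono' subsetI)
    fix D assume "D \<in> {(\<lambda>\<omega>. h (Z \<omega>)) -` A \<inter> space M | A. A \<in> sets Q}"
    then obtain A where A: "A \<in> sets Q" "D = (\<lambda>\<omega>. h (Z \<omega>)) -` A \<inter> space M" by auto
    have "D = Z -` (h -` A \<inter> space R) \<inter> space M"
      using A measurable_space[OF Z] by auto
    then show "D \<in> {Z -` A \<inter> space M | A. A \<in> sets R}"
      using measurable_sets[OF h A(1)] by blast
  qed
  have "random_variable N (\<lambda>\<omega>. f (X \<omega>))" "random_variable N' (\<lambda>\<omega>. g (Y \<omega>))"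
    using measurable_compose[OF X f] measurable_compose[OF Y g] by auto
  then show ?thesis
    using set sub[OF X f] sub[OF Y g] unfolding indep_var_eq indep_sets2_eq by blast
qed

text \<open>Knowing \<open>X\<close> fixes \<open>g (X \<omega>)\<close> and says nothing about
  \<open>w (Z \<omega>)\<close>, which is replaced by its mean. The map \<open>g\<close> is kept
  apart from \<open>X\<close> because the conditioning is on a whole random vector while the
  real-valued factor will be one of its coordinates.\<close>

lemma (in prob_space) real_cond_exp_indep_mult:
  fixes w :: "'b \<Rightarrow> real" and g :: "'c \<Rightarrow> real"
  assumes ind: "indep_elems S Z T X"
    and w: "w \<in> borel_measurable S" and g: "g \<in> borel_measurable T"
    and intW: "integrable M (\<lambda>\<omega>. w (Z \<omega>))" and intg: "integrable M (\<lambda>\<omega>. g (X \<omega>))"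
  shows "AE \<omega> in M. real_cond_exp M (vimage_algebra (space M) X T) (\<lambda>\<omega>. w (Z \<omega>) * g (X \<omega>)) \<omega>
           = expectation (\<lambda>\<omega>. w (Z \<omega>)) * g (X \<omega>)"
proof -
  let ?F = "vimage_algebra (space M) X T"
  have X: "random_variable T X"
    using ind unfolding indep_elems_def by auto
  then have Xs: "X \<in> space M \<rightarrow> space T"
    by (auto dest: measurable_space)
  have sub: "subalgebra M ?F"
    using X Xs unfolding subalgebra_def by (auto simp: sets_vimage_algebra2 measurable_sets)
  \<comment> \<open>Finiteness of \<open>M\<close> makes its restriction to \<open>?F\<close>
    sigma-finite, as the theory of \<open>real_cond_exp\<close> requires.\<close>
  interpret finite_measure_subalgebra M ?F
    by unfold_locales (rule sub)
  show ?thesis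
  proof (rule real_cond_exp_charact)
    fix A assume "A \<in> sets ?F"
    then obtain B where B: "B \<in> sets T" and A: "A = X -` B \<inter> space M"
      by (auto simp: sets_vimage_algebra2[OF Xs])
    \<comment> \<open>An event of \<open>?F\<close> is a condition on the value of \<open>X\<close>,
      so its indicator can be absorbed into \<open>g\<close>. What remains is a single function of
      \<open>X\<close>, to which the product rule applies against
      \<open>w (Z \<omega>)\<close>.\<close>
    let ?h = "\<lambda>x. indicator B x * g x"
    have h: "?h \<in> borel_measurable T"
      using B g by measurable
    have AX: "indicator A \<omega> = (indicator B (X \<omega>) :: real)" if "\<omega> \<in> space M" for \<omega>
      using that by (simp add: A indicator_def)
    have "A \<in> events"
      using X B unfolding A by (rule measurable_sets)
    then have "integrable M (\<lambda>\<omega>. indicator A \<omega> *\<^sub>R g (X \<omega>))"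
      using intg by (rule integrable_mult_indicator)
    then have inth: "integrable M (\<lambda>\<omega>. ?h (X \<omega>))"
      by (subst (asm) Bochner_Integration.integrable_cong[OF refl]) (auto simp: AX)
    have "(\<integral>\<omega>\<in>A. w (Z \<omega>) * g (X \<omega>) \<partial>M) = expectation (\<lambda>\<omega>. w (Z \<omega>) * ?h (X \<omega>))"
      unfolding set_lebesgue_integral_def
      by (rule Bochner_Integration.integral_cong) (auto simp: AX)
    also have "\<dots> = expectation (\<lambda>\<omega>. w (Z \<omega>)) * expectation (\<lambda>\<omega>. ?h (X \<omega>))"
      by (rule indep_var_lebesgue_integral[OF indep_elems_compose[OF ind w h] intW inth])
    also have "\<dots> = expectation (\<lambda>\<omega>. expectation (\<lambda>\<omega>. w (Z \<omega>)) * ?h (X \<omega>))"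
      by simp
    also have "\<dots> = (\<integral>\<omega>\<in>A. expectation (\<lambda>\<omega>. w (Z \<omega>)) * g (X \<omega>) \<partial>M)"
      unfolding set_lebesgue_integral_def
      by (rule Bochner_Integration.integral_cong) (auto simp: AX)
    finally show "(\<integral>\<omega>\<in>A. w (Z \<omega>) * g (X \<omega>) \<partial>M)
        = (\<integral>\<omega>\<in>A. expectation (\<lambda>\<omega>. w (Z \<omega>)) * g (X \<omega>) \<partial>M)" .
  next
    show "integrable M (\<lambda>\<omega>. w (Z \<omega>) * g (X \<omega>))"
      \<comment> \<open>A product of integrable functions need not be integrable; independence of
        the factors ensures it here.\<close>
      by (rule indep_var_integrable[OF indep_elems_compose[OF ind w g] intW intg])
    show "integrable M (\<lambda>\<omega>. expectation (\<lambda>\<omega>. w (Z \<omega>)) * g (X \<omega>))"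
      using intg by simp
    show "(\<lambda>\<omega>. expectation (\<lambda>\<omega>. w (Z \<omega>)) * g (X \<omega>)) \<in> borel_measurable ?F"
      using measurable_compose[OF measurable_vimage_algebra1[OF Xs] g] by simp
  qed
qed

text \<open>The scalar identity applies to each coordinate with \<open>g\<close> the projection to
  it. There are finitely many coordinates, so the union of their exceptional null sets is still
  null.\<close>

lemma (in prob_space) vec_cond_exp_rv_indep_scaleR:
  fixes w :: "'b \<Rightarrow> real" and X :: "'a \<Rightarrow> real ^ 'd"
  assumes ind: "indep_elems S Z borel X"
    and w: "w \<in> borel_measurable S"
    and intW: "integrable M (\<lambda>\<omega>. w (Z \<omega>))" and intX: "integrable M X"
  shows "AE \<omega> in M. vec_cond_exp_rv M (\<lambda>\<omega>. w (Z \<omega>) *\<^sub>R X \<omega>) X \<omega>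
           = expectation (\<lambda>\<omega>. w (Z \<omega>)) *\<^sub>R X \<omega>"
proof -
  have "integrable M (\<lambda>\<omega>. X \<omega> $ k)" for k
    using intX by (rule integrable_bounded_linear[OF bounded_linear_vec_nth])
  then have "AE \<omega> in M. \<forall>k. real_cond_exp M (vimage_algebra (space M) X borel)
      (\<lambda>\<omega>. w (Z \<omega>) * X \<omega> $ k) \<omega> = expectation (\<lambda>\<omega>. w (Z \<omega>)) * X \<omega> $ k"
    unfolding AE_all_countable
    by (intro allI real_cond_exp_indep_mult[OF ind w _ intW]) auto
  then show ?thesis
    unfolding vec_cond_exp_rv_def vec_cond_exp_def by (auto simp: vec_eq_iff)
qed

theorem lemma1:
  fixes M :: "'a measure" and n :: nat
    and p :: "nat \<Rightarrow> real" and pp :: "nat \<Rightarrow> nat \<Rightarrow> real"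
    and up :: "nat \<Rightarrow> nat \<Rightarrow> 'a \<Rightarrow> real"
    and link :: "nat \<Rightarrow> nat \<Rightarrow> nat \<Rightarrow> 'a \<Rightarrow> real"
    and dx :: "nat \<Rightarrow> nat \<Rightarrow> 'a \<Rightarrow> real ^ 'd"
    and \<alpha> :: "nat \<Rightarrow> nat \<Rightarrow> real"
  assumes network: "relay_network M n p pp up link dx"
    and weights_expectation:
      "\<forall>i\<in>{1..n}. \<forall>r.
         (\<integral>\<omega>. (\<Sum>j\<in>{1..n}. up j (Suc r) \<omega> * link i j (Suc r) \<omega> * \<alpha> j i) \<partial>M)
         = p i * \<alpha> i i + (\<Sum>j\<in>{1..n} - {i}. p j * pp i j * \<alpha> j i)"
    and weights_one:
      "\<forall>i\<in>{1..n}. p i * \<alpha> i i + (\<Sum>j\<in>{1..n} - {i}. p j * pp i j * \<alpha> j i) = 1"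
  shows "\<forall>i\<in>{1..n}. \<forall>r. AE \<omega> in M.
           (1 / real n) *\<^sub>R
             vec_cond_exp_rv M
               (\<lambda>\<omega>'. \<Sum>j\<in>{1..n}.
                  (up j (Suc r) \<omega>' * link i j (Suc r) \<omega>' * \<alpha> j i) *\<^sub>R dx i (Suc r) \<omega>')
               (dx i (Suc r)) \<omega>
           = (1 / real n) *\<^sub>R dx i (Suc r) \<omega>"
proof (intro ballI allI)
  interpret relay_network M n p pp up link dx by (rule network)
  fix i r assume i: "i \<in> {1..n}"
  let ?S = "Pi\<^sub>M {1..n} (\<lambda>_. borel :: real measure)
    \<Otimes>\<^sub>M Pi\<^sub>M ({1..n} \<times> {1..n}) (\<lambda>_. borel :: real measure)"
  \<comment> \<open>\<open>Z\<close> is literally the random element of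
    \<open>network_dx_indep\<close>, and \<open>w\<close> recovers the coefficient from it.
    Independence of the joint family is essential, since the coefficient depends on many links at
    once.\<close>
  define Z where "Z = (\<lambda>\<omega>. (\<lambda>i\<in>{1..n}. up i (Suc r) \<omega>,
    \<lambda>(i, j)\<in>{1..n} \<times> {1..n}. link i j (Suc r) \<omega>))"
  define w where "w = (\<lambda>z :: (nat \<Rightarrow> real) \<times> (nat \<times> nat \<Rightarrow> real).
    \<Sum>j\<in>{1..n}. fst z j * snd z (i, j) * \<alpha> j i)"
  let ?W = "\<lambda>\<omega>. \<Sum>j\<in>{1..n}. up j (Suc r) \<omega> * link i j (Suc r) \<omega> * \<alpha> j i"
  have wZ: "w (Z \<omega>) = ?W \<omega>" for \<omega>
    unfolding w_def Z_def using i by (intro sum.cong) auto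
  have ind: "indep_elems ?S Z borel (dx i (Suc r))"
    unfolding Z_def by (rule network_dx_indep[OF i])
  have "(\<lambda>z. fst z j * snd z (i, j) * \<alpha> j i) \<in> borel_measurable ?S" if "j \<in> {1..n}" for j
    using i that
    by (intro borel_measurable_times measurable_const
        measurable_compose[OF measurable_fst measurable_component_singleton]
        measurable_compose[OF measurable_snd measurable_component_singleton]) auto
  then have w: "w \<in> borel_measurable ?S"
    unfolding w_def by (rule borel_measurable_sum)
  have "integrable M (\<lambda>\<omega>. up j (Suc r) \<omega> * link i j (Suc r) \<omega>)" if j: "j \<in> {1..n}" for j
    by (rule indep_var_integrable[OF up_link_indep_var[OF i j j]
        bernoulli_rv_expectation(1)[OF up_bernoulli[OF j]]
        bernoulli_rv_expectation(1)[OF link_bernoulli[OF i j]]])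
  then have intW: "integrable M (\<lambda>\<omega>. w (Z \<omega>))"
    unfolding wZ by (intro Bochner_Integration.integrable_sum integrable_mult_left)
  \<comment> \<open>The weight condition enters here: it makes the relayed update unbiased.\<close>
  have "expectation (\<lambda>\<omega>. w (Z \<omega>)) = 1"
    unfolding wZ using weights_expectation weights_one i by simp
  then have "AE \<omega> in M.
      vec_cond_exp_rv M (\<lambda>\<omega>. ?W \<omega> *\<^sub>R dx i (Suc r) \<omega>) (dx i (Suc r)) \<omega> = dx i (Suc r) \<omega>"
    using vec_cond_exp_rv_indep_scaleR[OF ind w intW dx_integrable[OF i]] by (simp add: wZ)
  \<comment> \<open>All summands scale the same vector, so their sum is the total coefficient times
    that vector; the factor \<open>1 / real n\<close> multiplies both sides.\<close>
  then show "AE \<omega> in M.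
           (1 / real n) *\<^sub>R
             vec_cond_exp_rv M
               (\<lambda>\<omega>'. \<Sum>j\<in>{1..n}.
                  (up j (Suc r) \<omega>' * link i j (Suc r) \<omega>' * \<alpha> j i) *\<^sub>R dx i (Suc r) \<omega>')
               (dx i (Suc r)) \<omega>
           = (1 / real n) *\<^sub>R dx i (Suc r) \<omega>"
    by (auto simp: scaleR_left.sum)
qed

end
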